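(* For $N\ge 1$ let $\mathcal{P}(N)$ be the number of $A=(A_0,\dots,A_4)\in\mathbb{Z}^5$ with $\max_i|A_i|\le N$, $\gcd(A_0,\dots,A_4)=1$, and such that the variety $\mathcal{V}_A:\ \sum_{i=0}^4A_iX_i^5=0$ has infinitely many non-trivial integer points. Then $\mathcal{P}(N)\gg N^{1/10}$, i.e. there is a constant $c>0$ with $\mathcal{P}(N)\ge cN^{1/10}$ for all sufficiently large $N$.
   Context: An integer point $(X_0,\dots,X_4)\in\mathbb{Z}^5$ on $\mathcal{V}_A$ is called non-trivial if $\gcd(X_0,\dots,X_4)=1$ and no proper (nonempty) sub-sum of $\sum_{i=0}^4 A_iX_i^5$ vanishes. *)

theory Defs
  imports Complex_Main "HOL-Analysis.Finite_Cartesian_Product"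
begin

text \<open>
  The index type \<open>5\<close> is the ring of integers modulo five, with the elements
  \<open>0, 1, 2, 3, 4\<close>, so the coordinates of a vector \<open>A\<close> are
  \<open>A $ 0, \<dots>, A $ 4\<close>.
\<close>

definition quintic_points :: "int ^ 5 \<Rightarrow> (int ^ 5) set" where
  "quintic_points A = {X. (\<Sum>i\<in>UNIV. A $ i * X $ i ^ 5) = 0}"

definition nontrivial_point :: "int ^ 5 \<Rightarrow> int ^ 5 \<Rightarrow> bool" where
  "nontrivial_point A X \<longleftrightarrow>
     X \<in> quintic_points A \<and>
     (GCD i. X $ i) = 1 \<and>
     (\<forall>S. S \<noteq> {} \<and> S \<subset> UNIV \<longrightarrow> (\<Sum>i\<in>S. A $ i * X $ i ^ 5) \<noteq> 0)"

definition quintic_coeffs :: "real \<Rightarrow> (int ^ 5) set" where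
  "quintic_coeffs N =
     {A. real_of_int (MAX i. \<bar>A $ i\<bar>) \<le> N \<and>
         (GCD i. A $ i) = 1 \<and>
         infinite {X. nontrivial_point A X}}"

lemma finite_quintic_coeffs: "finite (quintic_coeffs N)"
proof -
  have "vec_nth ` quintic_coeffs N \<subseteq> (UNIV :: 5 set) \<rightarrow>\<^sub>E {- \<lfloor>N\<rfloor>..\<lfloor>N\<rfloor>}"
    by (auto simp: quintic_coeffs_def le_floor_iff [symmetric] abs_le_iff)
       (metis minus_le_iff)
  moreover have "finite ((UNIV :: 5 set) \<rightarrow>\<^sub>E {- \<lfloor>N\<rfloor>..\<lfloor>N\<rfloor>})"
    by (intro finite_PiE) auto
  ultimately have "finite (vec_nth ` quintic_coeffs N)"
    by (rule finite_subset)
  then show ?thesis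
    by (rule finite_imageD) (simp add: inj_on_def vec_nth_inject)
qed

definition quintic_count :: "real \<Rightarrow> nat" where
  "quintic_count N = card (quintic_coeffs N)"

end

theory Submission
  imports Defs "HOL-Number_Theory.Cong"
begin

text \<open>
  If \<open>y\<^sup>2 = 2 x\<^sup>2 + z\<^sup>2\<close>, then
  \<open>4 (z + x)\<^sup>5 + 4 (z - x)\<^sup>5 - (z + y)\<^sup>5 - (z - y)\<^sup>5 + 24 z\<^sup>5 = 0\<close>. Inserting the points
  \<open>x = 2 t\<close>, \<open>y = 2 t\<^sup>2 + 1\<close>, \<open>z = 2 t\<^sup>2 - 1\<close> of this conic gives infinitely many points
  for the coefficients \<open>(4, 4, -1, -1, 24)\<close>, and the fourth coordinate \<open>z - y = -2\<close> is constant.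
  For odd \<open>b\<close>, the fourth coefficient can therefore be multiplied by \<open>b\<^sup>5\<close>: multiplying the
  other four coordinates by \<open>b\<close> gives a point that is still primitive. Sub-sums do not vanish
  when \<open>t\<close> is congruent to 1 modulo 2000, because at \<open>t = 1\<close> they are nonzero and smaller
  than 2000 in absolute value.
\<close>

lemma exhaust_5: "x = 0 \<or> x = 1 \<or> x = 2 \<or> x = 3 \<or> x = 4" for x :: 5
proof (cases x)
  case (of_int z)
  then have "z = 0 \<or> z = 1 \<or> z = 2 \<or> z = 3 \<or> z = 4"
    by simp arith
  then show ?thesis
    using of_int by auto
qed

lemma UNIV_5: "UNIV = {0, 1, 2, 3, 4 :: 5}"
  using exhaust_5 by auto

definition vec5 :: "'a \<Rightarrow> 'a \<Rightarrow> 'a \<Rightarrow> 'a \<Rightarrow> 'a \<Rightarrow> 'a ^ 5" where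
  "vec5 a b c d e =
     (\<chi> i. if i = 0 then a else if i = 1 then b else if i = 2 then c else if i = 3 then d else e)"

lemma vec5_nth [simp]:
  "vec5 a b c d e $ 0 = a" "vec5 a b c d e $ 1 = b" "vec5 a b c d e $ 2 = c"
  "vec5 a b c d e $ 3 = d" "vec5 a b c d e $ 4 = e"
  by (simp_all add: vec5_def)

lemma range_vec5: "range (($) (vec5 a b c d e)) = {a, b, c, d, e}"
  by (simp add: UNIV_5)

lemma vec5_comp: "(\<lambda>i. f (vec5 a b c d e $ i)) = ($) (vec5 (f a) (f b) (f c) (f d) (f e))"
  by (auto simp: vec5_def fun_eq_iff)

text \<open>These are the five summands for \<open>b = 1\<close>. Keeping them free of
  \<open>b\<close> reduces every sub-sum question to the parameter \<open>t\<close> alone.\<close>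

definition base_terms :: "int \<Rightarrow> int ^ 5" where
  "base_terms t = vec5 (4 * (2 * t\<^sup>2 + 2 * t - 1) ^ 5) (4 * (2 * t\<^sup>2 - 2 * t - 1) ^ 5)
     (- ((4 * t\<^sup>2) ^ 5)) 32 (24 * (2 * t\<^sup>2 - 1) ^ 5)"

lemma sum_base_terms: "(\<Sum>i\<in>UNIV. base_terms t $ i) = 0"
  unfolding base_terms_def UNIV_5 by simp algebra

text \<open>The summands are 972, -4, -1024, 32, 24. Cancelling -1024 takes all three positive ones,
  whose total 1028 then calls for -4 as well; without -1024, the only negative summand -4 is too
  small to cancel a positive one. The positive and the negative summands each total 1028 in absolute
  value, hence the bound.\<close>

lemma base_terms_1_subsum:
  assumes "S \<noteq> {}" "S \<subset> UNIV"
  shows "(\<Sum>i\<in>S. base_terms 1 $ i) \<noteq> 0" "\<bar>\<Sum>i\<in>S. base_terms 1 $ i\<bar> < 2000"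
proof -
  have sum: "(\<Sum>i\<in>S. base_terms 1 $ i) = (if 0 \<in> S then 972 else 0) + (if 1 \<in> S then - 4 else 0) +
      (if 2 \<in> S then - 1024 else 0) + (if 3 \<in> S then 32 else 0) + (if 4 \<in> S then 24 else 0)"
  proof -
    have "(\<Sum>i\<in>S. base_terms 1 $ i) = (\<Sum>i\<in>UNIV. if i \<in> S then base_terms 1 $ i else 0)"
      by (simp add: sum.If_cases)
    also have "\<dots> = (if 0 \<in> S then 972 else 0) + (if 1 \<in> S then - 4 else 0) +
      (if 2 \<in> S then - 1024 else 0) + (if 3 \<in> S then 32 else 0) + (if 4 \<in> S then 24 else 0)"
      unfolding UNIV_5 base_terms_def by simp
    finally show ?thesis .
  qed
  have ne: "0 \<in> S \<or> 1 \<in> S \<or> 2 \<in> S \<or> 3 \<in> S \<or> 4 \<in> S"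
    using assms(1) exhaust_5 by (metis all_not_in_conv)
  have pr: "\<not> (0 \<in> S \<and> 1 \<in> S \<and> 2 \<in> S \<and> 3 \<in> S \<and> 4 \<in> S)"
  proof
    assume "0 \<in> S \<and> 1 \<in> S \<and> 2 \<in> S \<and> 3 \<in> S \<and> 4 \<in> S"
    then have "{0, 1, 2, 3, 4} \<subseteq> S"
      by simp
    then show False
      using assms(2) by (simp flip: UNIV_5 add: top.extremum_unique)
  qed
  show "(\<Sum>i\<in>S. base_terms 1 $ i) \<noteq> 0"
    unfolding sum using ne pr by (auto split: if_split)
  show "\<bar>\<Sum>i\<in>S. base_terms 1 $ i\<bar> < 2000"
    unfolding sum by (simp split: if_split)
qed

lemma base_terms_cong:
  assumes "[t = s] (mod m)"
  shows "[base_terms t $ i = base_terms s $ i] (mod m)"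
proof -
  note cong = cong_mult cong_add cong_diff cong_pow cong_refl cong_minus_minus_iff [THEN iffD2] assms
  show ?thesis
    using exhaust_5 [of i] unfolding base_terms_def
    by (elim disjE) (simp_all only: vec5_nth, (intro cong)+)
qed

lemma base_terms_subsum_nonzero:
  assumes "[t = 1] (mod 2000)" "S \<noteq> {}" "S \<subset> UNIV"
  shows "(\<Sum>i\<in>S. base_terms t $ i) \<noteq> 0"
proof
  assume "(\<Sum>i\<in>S. base_terms t $ i) = 0"
  moreover have "[(\<Sum>i\<in>S. base_terms t $ i) = (\<Sum>i\<in>S. base_terms 1 $ i)] (mod 2000)"
    using assms(1) by (intro cong_sum base_terms_cong)
  ultimately have "2000 dvd (\<Sum>i\<in>S. base_terms 1 $ i)"
    by (metis cong_0_iff cong_sym)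
  then show False
    using base_terms_1_subsum [OF assms(2,3)] zdvd_imp_le [of 2000 "\<bar>\<Sum>i\<in>S. base_terms 1 $ i\<bar>"]
    by simp
qed

definition coeffs :: "int \<Rightarrow> int ^ 5" where
  "coeffs b = vec5 4 4 (- 1) (- (b ^ 5)) 24"

definition curve_point :: "int \<Rightarrow> int \<Rightarrow> int ^ 5" where
  "curve_point b t = vec5 (b * (2 * t\<^sup>2 + 2 * t - 1)) (b * (2 * t\<^sup>2 - 2 * t - 1)) (b * (4 * t\<^sup>2))
     (- 2) (b * (2 * t\<^sup>2 - 1))"

text \<open>The factor \<open>b ^ 5\<close> comes from the coefficient at index 3 and from the
  coordinate at every other index.\<close>

lemma coeffs_curve_point: "coeffs b $ i * curve_point b t $ i ^ 5 = b ^ 5 * base_terms t $ i"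
  using exhaust_5 [of i] unfolding coeffs_def curve_point_def base_terms_def
  by (elim disjE) (simp_all add: power_mult_distrib)

lemma nontrivial_curve_point:
  assumes "odd b" "[t = 1] (mod 2000)"
  shows "nontrivial_point (coeffs b) (curve_point b t)"
proof -
  have subsum: "(\<Sum>i\<in>S. coeffs b $ i * curve_point b t $ i ^ 5) = b ^ 5 * (\<Sum>i\<in>S. base_terms t $ i)" for S
    by (simp add: coeffs_curve_point sum_distrib_left)
  \<comment> \<open>Primitivity is read off from the coordinates at indices 3 and 4: one is -2, the
    other is odd because \<open>b\<close> is odd.\<close>
  have "coprime (b * (2 * t\<^sup>2 - 1)) 2"
    using assms(1) by simp
  moreover have "(GCD i. curve_point b t $ i) dvd curve_point b t $ k" for k
    by (rule Gcd_dvd) simp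
  from this [of 4] this [of 3]
  have "(GCD i. curve_point b t $ i) dvd b * (2 * t\<^sup>2 - 1)" "(GCD i. curve_point b t $ i) dvd 2"
    by (simp_all only: curve_point_def vec5_nth dvd_minus_iff)
  ultimately have "is_unit (GCD i. curve_point b t $ i)"
    by (rule coprime_common_divisor)
  then have "(GCD i. curve_point b t $ i) = 1"
    by simp
  moreover have "b \<noteq> 0"
    using assms(1) by auto
  ultimately show ?thesis
    unfolding nontrivial_point_def quintic_points_def
    using sum_base_terms base_terms_subsum_nonzero [OF assms(2)] by (simp add: subsum)
qed

lemma infinite_nontrivial_points:
  assumes "odd b"
  shows "infinite {X. nontrivial_point (coeffs b) X}"
proof -
  let ?P = "\<lambda>n. curve_point b (1 + 2000 * int n)"
  have "b \<noteq> 0"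
    using assms by auto
  have "inj ?P"
  proof (rule injI)
    fix m n
    assume "?P m = ?P n"
    \<comment> \<open>This coordinate is \<open>b * (4 * t\<^sup>2)\<close>, which determines a
      positive \<open>t\<close>.\<close>
    then have "?P m $ 2 = ?P n $ 2"
      by simp
    then have "(1 + 2000 * int m)\<^sup>2 = (1 + 2000 * int n)\<^sup>2"
      using \<open>b \<noteq> 0\<close> by (simp add: curve_point_def)
    then show "m = n"
      by (simp add: power2_eq_iff_nonneg)
  qed
  moreover have "range ?P \<subseteq> {X. nontrivial_point (coeffs b) X}"
    using nontrivial_curve_point [OF assms] by (auto simp: cong_iff_dvd_diff)
  ultimately show ?thesis
    using range_inj_infinite infinite_super by blast
qed

lemma coeffs_in_quintic_coeffs:
  assumes "odd b" "\<bar>real_of_int b\<bar> ^ 5 \<le> N" "24 \<le> N"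
  shows "coeffs b \<in> quintic_coeffs N"
proof -
  have "(MAX i. \<bar>coeffs b $ i\<bar>) = Max {4, 4, 1, \<bar>b\<bar> ^ 5, 24}"
    unfolding coeffs_def vec5_comp range_vec5 by (simp add: power_abs)
  also have "real_of_int \<dots> \<le> N"
    using assms(2,3) by (simp add: max_def)
  finally have "real_of_int (MAX i. \<bar>coeffs b $ i\<bar>) \<le> N" .
  moreover have "(GCD i. coeffs b $ i) = 1"
    unfolding coeffs_def range_vec5
    \<comment> \<open>The entry -1 at index 2 makes the vector primitive for every
      \<open>b\<close>.\<close>
    by (rule Gcd_eq_1_I [of "- 1"]) auto
  ultimately show ?thesis
    using infinite_nontrivial_points [OF assms(1)] by (simp add: quintic_coeffs_def)
qed

lemma inj_on_coeffs: "inj_on coeffs {0..}"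
proof (rule inj_onI)
  fix b c :: int
  assume nonneg: "b \<in> {0..}" "c \<in> {0..}" and "coeffs b = coeffs c"
  then have "coeffs b $ 3 = coeffs c $ 3"
    by simp
  then have "b ^ 5 = c ^ 5"
    by (simp add: coeffs_def)
  then show "b = c"
    using nonneg by (simp add: power_eq_iff_eq_base)
qed

text \<open>The first \<open>n\<close> odd numbers 1, 3, ..., 2n - 1 all lie below 2n, and as values
  of \<open>b\<close> they give distinct coefficient vectors.\<close>

lemma quintic_count_ge:
  assumes "(2 * real n) ^ 5 \<le> N" "24 \<le> N"
  shows "n \<le> quintic_count N"
proof -
  let ?f = "\<lambda>k. coeffs (2 * int k + 1)"
  have "?f k \<in> quintic_coeffs N" if "k < n" for k
  proof (rule coeffs_in_quintic_coeffs)
    have "\<bar>real_of_int (2 * int k + 1)\<bar> ^ 5 \<le> (2 * real n) ^ 5"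
      using that by (intro power_mono) auto
    then show "\<bar>real_of_int (2 * int k + 1)\<bar> ^ 5 \<le> N"
      using assms(1) by linarith
  qed (use assms in auto)
  moreover have "inj_on ?f {..<n}"
    by (auto intro!: inj_onI dest: inj_onD [OF inj_on_coeffs])
  ultimately have "card {..<n} \<le> card (quintic_coeffs N)"
    using finite_quintic_coeffs by (intro card_inj_on_le) auto
  then show ?thesis
    by (simp add: quintic_count_def)
qed

theorem theorem3p3:
  "\<exists>c>0. \<exists>N\<^sub>0\<ge>1. \<forall>N\<ge>N\<^sub>0. real (quintic_count N) \<ge> c * N powr (1 / 10)"
\<comment> \<open>The factor 1/2 absorbs rounding \<open>y\<close> down to \<open>n\<close>, and
  \<open>1024 = 2 ^ 10\<close> ensures \<open>2 \<le> y\<close>.\<close>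
proof (rule exI [of _ "1 / 2"], rule conjI, simp, rule exI [of _ 1024], intro conjI allI impI)
  fix N :: real
  assume N: "1024 \<le> N"
  define y where "y = N powr (1 / 10)"
  define n where "n = nat \<lfloor>y\<rfloor>"
  have "1 \<le> y"
    using N by (simp add: y_def ge_one_powr_ge_zero)
  then have "1 \<le> \<lfloor>y\<rfloor>"
    by simp
  then have n: "real n \<le> y" "y / 2 \<le> real n"
    unfolding n_def by linarith+
  have "y ^ 10 = N"
    using N by (simp add: y_def powr_powr flip: powr_realpow)
  then have "(2::real) ^ 10 \<le> y ^ 10"
    using N by simp
  then have "2 \<le> y"
    using \<open>1 \<le> y\<close> power_le_imp_le_base [of 2 9 y] by simp
  \<comment> \<open>Since \<open>2 \<le> y\<close> and \<open>n \<le> y\<close>, the product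
    \<open>2 * n\<close> is at most \<open>y * y\<close>, the fifth root of
    \<open>N\<close>.\<close>
  have "(2 * real n) ^ 5 \<le> (y * y) ^ 5"
    using n \<open>2 \<le> y\<close> by (intro power_mono mult_mono) auto
  also have "\<dots> = N"
    using \<open>y ^ 10 = N\<close> by (simp add: power_mult_distrib flip: power_add)
  finally have "n \<le> quintic_count N"
    using N by (intro quintic_count_ge) auto
  then show "1 / 2 * N powr (1 / 10) \<le> real (quintic_count N)"
    using n by (simp flip: y_def)
qed simp

end
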